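(* Let $G$ be a finite simple connected graph of order $n \ge 2$. Then $RC(G) \le C(G)$, where $C(G)$ is the coalition number and $RC(G)$ is the restrained dominating coalition number of $G$.
   Context: All graphs are finite, simple and connected; the order of a graph is its number of vertices. Let $G$ be a graph with vertex set $V$. A subset $D \subseteq V$ is a dominating set if every vertex of $V \setminus D$ is adjacent to a vertex of $D$. A subset $R \subseteq V$ is a restrained dominating set (RD-set) if $R$ is a dominating set and every vertex of $V \setminus R$ has at least one neighbor in $V \setminus R$ (in particular $V$ itself is an RD-set). Two disjoint subsets of $V$ form a (dominating) coalition if neither of them is a dominating set but their union is a dominating set. A coalition partition of $G$ is a partition $\pi$ of $V$ into nonempty sets such that every set of $\pi$ that is not dominating forms a coalition with some other set of $\pi$, and every set of $\pi$ that is dominating is a single-vertex set. The coalition number $C(G)$ is the maximum cardinality of a coalition partition of $G$. Two disjoint subsets of $V$ form a restrained dominating coalition (RD-coalition) if neither of them is an RD-set but their union is an RD-set. A restrained dominating coalition partition (RD-partition) of $G$ is a partition $\pi$ of $V$ into nonempty sets such that every set of $\pi$ that is not an RD-set forms an RD-coalition with some other set of $\pi$, and every set of $\pi$ that is an RD-set is a single-vertex set. The restrained dominating coalition number $RC(G)$ is the maximum cardinality of an RD-partition of $G$. *)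

theory Defs
  imports
    "Graph_Theory.Digraph_Component"
    "HOL-Library.Disjoint_Sets"
begin

text \<open>
  A finite simple graph is the locale \<open>graph\<close>: a finite, loop-free, symmetric digraph without
  parallel arcs, where each undirected edge is represented by its two opposite arcs. The
  library notation \<open>u \<rightarrow>\<^bsub>G\<^esub> v\<close> therefore means that \<open>u\<close> and \<open>v\<close> are adjacent.
\<close>

definition dominating_set :: "('a, 'b) pre_digraph \<Rightarrow> 'a set \<Rightarrow> bool" where
  "dominating_set G D \<longleftrightarrow>
     D \<subseteq> verts G \<and> (\<forall>v \<in> verts G - D. \<exists>u \<in> D. v \<rightarrow>\<^bsub>G\<^esub> u)"

definition restrained_dominating_set :: "('a, 'b) pre_digraph \<Rightarrow> 'a set \<Rightarrow> bool" where
  "restrained_dominating_set G R \<longleftrightarrow>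
     dominating_set G R \<and> (\<forall>v \<in> verts G - R. \<exists>u \<in> verts G - R. v \<rightarrow>\<^bsub>G\<^esub> u)"

definition coalition :: "('a, 'b) pre_digraph \<Rightarrow> 'a set \<Rightarrow> 'a set \<Rightarrow> bool" where
  "coalition G A B \<longleftrightarrow>
     A \<subseteq> verts G \<and> B \<subseteq> verts G \<and> A \<inter> B = {} \<and>
     \<not> dominating_set G A \<and> \<not> dominating_set G B \<and> dominating_set G (A \<union> B)"

definition rd_coalition :: "('a, 'b) pre_digraph \<Rightarrow> 'a set \<Rightarrow> 'a set \<Rightarrow> bool" where
  "rd_coalition G A B \<longleftrightarrow>
     A \<subseteq> verts G \<and> B \<subseteq> verts G \<and> A \<inter> B = {} \<and>
     \<not> restrained_dominating_set G A \<and> \<not> restrained_dominating_set G B \<and>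
     restrained_dominating_set G (A \<union> B)"

definition coalition_partition :: "('a, 'b) pre_digraph \<Rightarrow> 'a set set \<Rightarrow> bool" where
  "coalition_partition G \<pi> \<longleftrightarrow>
     partition_on (verts G) \<pi> \<and>
     (\<forall>A \<in> \<pi>. \<not> dominating_set G A \<longrightarrow> (\<exists>B \<in> \<pi> - {A}. coalition G A B)) \<and>
     (\<forall>A \<in> \<pi>. dominating_set G A \<longrightarrow> is_singleton A)"

definition rd_partition :: "('a, 'b) pre_digraph \<Rightarrow> 'a set set \<Rightarrow> bool" where
  "rd_partition G \<pi> \<longleftrightarrow>
     partition_on (verts G) \<pi> \<and>
     (\<forall>A \<in> \<pi>. \<not> restrained_dominating_set G A \<longrightarrow> (\<exists>B \<in> \<pi> - {A}. rd_coalition G A B)) \<and>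
     (\<forall>A \<in> \<pi>. restrained_dominating_set G A \<longrightarrow> is_singleton A)"

text \<open>
  For a finite graph the sets of cardinalities below are finite; on a nonempty set of natural
  numbers \<open>Sup\<close> is \<open>Max\<close>, and it is \<open>0\<close> on the empty set.
\<close>

definition coalition_number :: "('a, 'b) pre_digraph \<Rightarrow> nat" where
  "coalition_number G = Sup {card \<pi> |\<pi>. coalition_partition G \<pi>}"

definition rd_coalition_number :: "('a, 'b) pre_digraph \<Rightarrow> nat" where
  "rd_coalition_number G = Sup {card \<pi> |\<pi>. rd_partition G \<pi>}"

end

theory Submission
  imports Defs
begin

text \<open>
  An RD-partition in which no member is dominating without being restrained dominating is already
  a coalition partition. So the case of interest is an RD-partition \<open>\<pi>\<close> with a
  dominating member \<open>A\<close> that is not restrained dominating. Some vertex \<open>v\<close> outside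
  \<open>A\<close> then has no neighbour outside \<open>A\<close>, and this one vertex controls the whole
  partition. A restrained dominating set that contains \<open>A\<close> must contain \<open>v\<close>, and so
  must a dominating set disjoint from \<open>A\<close>. Hence the partner \<open>B\<close> of \<open>A\<close> is
  the member that contains \<open>v\<close>, and \<open>B\<close> is the only possible partner of every
  member of \<open>\<pi>\<close> other than itself (lemma \<open>rd_partition_star\<close>).

  If \<open>B\<close> is not dominating, extend it to a maximal set \<open>M\<close> of vertices that is not
  dominating and consists of vertices not adjacent to all others. Every member of \<open>\<pi>\<close>
  except \<open>B\<close> completes \<open>B\<close> to a dominating set, hence is not contained in \<open>M\<close>
  and has a vertex outside \<open>M\<close>. So the partition into \<open>M\<close> and singletons has at
  least as many members as \<open>\<pi>\<close>, and it is a coalition partition by the maximality of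
  \<open>M\<close> (lemma \<open>coalition_partition_of_star\<close>). If \<open>B\<close> is dominating, the same
  analysis with \<open>A\<close> and \<open>B\<close> exchanged leaves no room for a third member, and every
  graph with at least two vertices has a coalition partition with at least two members.
\<close>

section \<open>Coalition partitions into one set and singletons\<close>

lemma dominating_set_mono:
  assumes "dominating_set G D" "D \<subseteq> E" "E \<subseteq> verts G"
  shows "dominating_set G E"
  using assms unfolding dominating_set_def by blast

lemma partition_on_unique:
  assumes "partition_on V \<pi>" "X \<in> \<pi>" "Y \<in> \<pi>" "v \<in> X" "v \<in> Y"
  shows "X = Y"
  using assms unfolding partition_on_def disjoint_def by blast

lemma (in graph) coalition_partition_of_singletons:
  assumes full: "\<And>u. u \<in> verts G \<Longrightarrow> dominating_set G {u}"
  shows "coalition_partition G ((\<lambda>u. {u}) ` verts G)"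
  using full unfolding coalition_partition_def partition_on_def disjoint_def by auto

text \<open>
  The maximality of \<open>M\<close> makes it a coalition partner of every singleton \<open>{w}\<close> outside it
  that is not dominating. The set \<open>M\<close> is chosen among the vertices that do not dominate by
  themselves so that such a \<open>w\<close> exists: these vertices form a dominating set, because each
  remaining vertex is adjacent to all others, so \<open>M\<close> cannot exhaust them.
\<close>

lemma (in graph) coalition_partition_around_maximal:
  assumes B: "B \<subseteq> verts G" "B \<noteq> {}" "\<not> dominating_set G B"
  obtains M where "B \<subseteq> M" "M \<subseteq> verts G" "\<not> dominating_set G M"
    "coalition_partition G (insert M ((\<lambda>w. {w}) ` (verts G - M)))"
proof -
  define W where "W = {u \<in> verts G. \<not> dominating_set G {u}}"
  let ?S = "{M. M \<subseteq> W \<and> \<not> dominating_set G M}"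
  have W: "W \<subseteq> verts G"
    unfolding W_def by blast
  have BW: "B \<subseteq> W"
  proof
    fix u assume u: "u \<in> B"
    then have "\<not> dominating_set G {u}"
      using B dominating_set_mono[of G "{u}" B] by blast
    then show "u \<in> W"
      using u B unfolding W_def by blast
  qed
  have "finite ?S"
    using finite_subset[OF W] by simp
  moreover have "B \<in> ?S"
    using BW B by blast
  ultimately obtain M where M: "M \<in> ?S" "B \<subseteq> M" and max: "\<forall>N\<in>?S. M \<subseteq> N \<longrightarrow> M = N"
    using finite_has_maximal2[of ?S B] by blast
  have MV: "M \<subseteq> verts G" and nM: "\<not> dominating_set G M" and MW: "M \<subseteq> W"
    using M W by auto
  have M_insert: "dominating_set G (insert w M)" if "w \<in> W - M" for w
  proof (rule ccontr)
    assume "\<not> dominating_set G (insert w M)"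
    then have "insert w M \<in> ?S"
      using MW that by simp
    then have "M = insert w M"
      using max by blast
    then show False
      using that by blast
  qed
  have domW: "dominating_set G W"
    unfolding dominating_set_def
  proof (intro conjI W ballI)
    fix x assume x: "x \<in> verts G - W"
    obtain w where w: "w \<in> W"
      using BW B by blast
    have "dominating_set G {x}"
      using x unfolding W_def by blast
    then have "w \<rightarrow>\<^bsub>G\<^esub> x"
      using w x W unfolding dominating_set_def by blast
    then show "\<exists>u\<in>W. x \<rightarrow>\<^bsub>G\<^esub> u"
      using w graph_symmetric by blast
  qed
  have "M \<noteq> W"
    using domW nM by auto
  then obtain w where w: "w \<in> W - M"
    using MW by blast
  have coal: "coalition G M {u}" if "u \<in> W - M" for u
    using that M_insert[OF that] nM MV unfolding coalition_def W_def by auto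
  have coal': "coalition G {u} M" if "u \<in> W - M" for u
    using coal[OF that] unfolding coalition_def by (simp add: Un_commute Int_commute)
  let ?\<sigma> = "insert M ((\<lambda>w. {w}) ` (verts G - M))"
  have "partition_on (verts G) ?\<sigma>"
    using MV M B unfolding partition_on_def disjoint_def by auto
  moreover have "\<exists>Y\<in>?\<sigma> - {X}. coalition G X Y" if X: "X \<in> ?\<sigma>" "\<not> dominating_set G X" for X
  proof (cases "X = M")
    case True
    then show ?thesis
      using coal[OF w] w W by (intro bexI[of _ "{w}"]) auto
  next
    case False
    then obtain u where u: "X = {u}" "u \<in> verts G - M"
      using X by blast
    then have "u \<in> W - M"
      using X unfolding W_def by blast
    then show ?thesis
      using coal' u by (intro bexI[of _ M]) auto
  qed
  moreover have "is_singleton X" if "X \<in> ?\<sigma>" "dominating_set G X" for X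
    using that nM by auto
  ultimately have "coalition_partition G ?\<sigma>"
    unfolding coalition_partition_def by blast
  then show thesis
    using that M MV nM by blast
qed

text \<open>
  A set \<open>M\<close> that contains \<open>B\<close> and is not dominating misses a vertex of each other member
  of \<open>\<pi>\<close>, and these vertices are distinct because the members are disjoint. This is what makes
  the partition into \<open>M\<close> and singletons large enough.
\<close>

lemma (in graph) coalition_partition_of_star:
  assumes part: "partition_on (verts G) \<pi>"
    and B: "B \<in> \<pi>" "\<not> dominating_set G B"
    and star: "\<And>X. X \<in> \<pi> - {B} \<Longrightarrow> dominating_set G (B \<union> X)"
  shows "\<exists>\<sigma>. coalition_partition G \<sigma> \<and> card \<pi> \<le> card \<sigma>"
proof -
  have BV: "B \<subseteq> verts G" "B \<noteq> {}"
    using part B unfolding partition_on_def by blast+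
  obtain M where M: "B \<subseteq> M" "M \<subseteq> verts G" "\<not> dominating_set G M"
    and \<sigma>: "coalition_partition G (insert M ((\<lambda>w. {w}) ` (verts G - M)))"
    by (rule coalition_partition_around_maximal[OF BV B(2)])
  have "\<forall>X \<in> \<pi> - {B}. \<exists>x. x \<in> X - M"
  proof
    fix X assume "X \<in> \<pi> - {B}"
    then have "\<not> X \<subseteq> M"
      using dominating_set_mono[OF star[of X], of M] M by blast
    then show "\<exists>x. x \<in> X - M"
      by blast
  qed
  then obtain f where "\<forall>X \<in> \<pi> - {B}. f X \<in> X - M"
    by (rule bchoice[THEN exE])
  then have f: "f X \<in> X - M" if "X \<in> \<pi> - {B}" for X
    using that by blast
  have "inj_on f (\<pi> - {B})"
  proof (rule inj_onI)
    fix X Y assume *: "X \<in> \<pi> - {B}" "Y \<in> \<pi> - {B}" "f X = f Y"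
    then show "X = Y"
      using partition_on_unique[OF part, of X Y "f X"] f[OF *(1)] f[OF *(2)] by simp
  qed
  moreover have "f ` (\<pi> - {B}) \<subseteq> verts G - M"
  proof (rule image_subsetI)
    fix X assume X: "X \<in> \<pi> - {B}"
    then have "X \<subseteq> verts G"
      using part unfolding partition_on_def by blast
    then show "f X \<in> verts G - M"
      using f[OF X] by blast
  qed
  ultimately have "card (\<pi> - {B}) \<le> card (verts G - M)"
    by (rule card_inj_on_le) simp
  moreover have "finite \<pi>"
    using finite_elements[OF _ part] by simp
  moreover have "card (insert M ((\<lambda>w. {w}) ` (verts G - M))) = Suc (card (verts G - M))"
  proof -
    have "M \<notin> (\<lambda>w. {w}) ` (verts G - M)"
      by auto
    then show ?thesis
      by (simp add: card_image)
  qed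
  ultimately have "card \<pi> \<le> card (insert M ((\<lambda>w. {w}) ` (verts G - M)))"
    using B card_Suc_Diff1[of \<pi> B] by linarith
  then show ?thesis
    using \<sigma> by blast
qed

text \<open>
  If some vertex \<open>u\<close> does not dominate by itself, then \<open>{u}\<close> and its complement satisfy the
  hypotheses of \<open>coalition_partition_of_star\<close>; they need not be a coalition partition themselves.
\<close>

lemma (in graph) coalition_partition_two_members:
  assumes "card (verts G) \<ge> 2"
  shows "\<exists>\<sigma>. coalition_partition G \<sigma> \<and> 2 \<le> card \<sigma>"
proof (cases "\<forall>u\<in>verts G. dominating_set G {u}")
  case True
  then have "coalition_partition G ((\<lambda>u. {u}) ` verts G)"
    by (intro coalition_partition_of_singletons) simp
  moreover have "card ((\<lambda>u. {u}) ` verts G) = card (verts G)"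
    by (simp add: card_image)
  ultimately show ?thesis
    using assms by metis
next
  case False
  then obtain u where u: "u \<in> verts G" "\<not> dominating_set G {u}"
    by blast
  let ?\<pi> = "{{u}, verts G - {u}}"
  have ne: "verts G - {u} \<noteq> {}"
  proof
    assume "verts G - {u} = {}"
    then have "card (verts G) \<le> card {u}"
      by (intro card_mono) auto
    then show False
      using assms by simp
  qed
  have part: "partition_on (verts G) ?\<pi>"
  proof (rule partition_onI)
    show "\<Union> ?\<pi> = verts G"
      using u by blast
    show "disjnt X Y" if "X \<in> ?\<pi>" "Y \<in> ?\<pi>" "X \<noteq> Y" for X Y
      using that unfolding disjnt_def by blast
    show "{} \<notin> ?\<pi>"
      using ne by blast
  qed
  have "dominating_set G ({u} \<union> X)" if "X \<in> ?\<pi> - {{u}}" for X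
  proof -
    have "{u} \<union> X = verts G"
      using that u by blast
    then show ?thesis
      by (simp add: dominating_set_def)
  qed
  then have "\<exists>\<sigma>. coalition_partition G \<sigma> \<and> card ?\<pi> \<le> card \<sigma>"
    by (rule coalition_partition_of_star[OF part insertI1 u(2)])
  moreover have "card ?\<pi> = 2"
  proof -
    have "{u} \<noteq> verts G - {u}"
      by auto
    then show ?thesis
      by (simp only: card_2_iff) metis
  qed
  ultimately show ?thesis
    by metis
qed

section \<open>RD-partitions with a dominating member\<close>

text \<open>
  The vertex \<open>v\<close> outside \<open>A\<close> that has no neighbour outside \<open>A\<close> pins down every
  partner. For a member \<open>X\<close> other than \<open>A\<close> and \<open>B\<close>, the union of \<open>X\<close> with
  its partner contains \<open>v\<close>, whether or not that partner is \<open>A\<close>; as \<open>v\<close> lies in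
  \<open>B\<close>, the partner is \<open>B\<close>.
\<close>

lemma (in graph) rd_partition_star:
  assumes \<pi>: "rd_partition G \<pi>" and A: "A \<in> \<pi>"
    and dom: "dominating_set G A" and nrd: "\<not> restrained_dominating_set G A"
  obtains B where "B \<in> \<pi> - {A}" "\<And>X. X \<in> \<pi> - {B} \<Longrightarrow> rd_coalition G X B"
proof -
  have part: "partition_on (verts G) \<pi>"
    and partner: "\<And>X. \<lbrakk>X \<in> \<pi>; \<not> restrained_dominating_set G X\<rbrakk> \<Longrightarrow> \<exists>Y\<in>\<pi> - {X}. rd_coalition G X Y"
    using \<pi> unfolding rd_partition_def by auto
  obtain v where v: "v \<in> verts G - A" and nb: "\<And>u. u \<in> verts G - A \<Longrightarrow> \<not> v \<rightarrow>\<^bsub>G\<^esub> u"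
    using dom nrd unfolding restrained_dominating_set_def by blast
  have v_super: "v \<in> R" if "restrained_dominating_set G R" "A \<subseteq> R" for R
    using that v nb unfolding restrained_dominating_set_def by blast
  have v_disj: "v \<in> D" if "dominating_set G D" "D \<inter> A = {}" for D
    using that v nb unfolding dominating_set_def by blast
  obtain B where B: "B \<in> \<pi> - {A}" "rd_coalition G A B"
    using partner[OF A nrd] by blast
  have vB: "v \<in> B"
    using v_super[of "A \<union> B"] B v unfolding rd_coalition_def by blast
  have "rd_coalition G X B" if X: "X \<in> \<pi> - {B}" for X
  proof (cases "X = A")
    case True
    then show ?thesis
      using B by simp
  next
    case False
    have vX: "v \<notin> X"
      using partition_on_unique[OF part, of X B v] X B vB by blast
    have disjA: "Y \<inter> A = {}" if "Y \<in> \<pi>" "Y \<noteq> A" for Y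
      using partition_on_unique[OF part, of Y A] that A by blast
    have "\<not> restrained_dominating_set G X"
      using v_disj[of X] vX disjA[of X] X False unfolding restrained_dominating_set_def by blast
    then obtain Y where Y: "Y \<in> \<pi> - {X}" "rd_coalition G X Y"
      using partner X by blast
    then have rd: "restrained_dominating_set G (X \<union> Y)"
      unfolding rd_coalition_def by blast
    have "v \<in> X \<union> Y"
    proof (cases "Y = A")
      case True
      then show ?thesis
        using v_super[OF rd] by blast
    next
      case False
      then have "(X \<union> Y) \<inter> A = {}"
        using disjA[of X] disjA[of Y] X Y \<open>X \<noteq> A\<close> by blast
      then show ?thesis
        using v_disj rd unfolding restrained_dominating_set_def by blast
    qed
    then have "Y = B"
      using partition_on_unique[OF part, of Y B v] vX vB Y B by blast
    then show ?thesis
      using Y by simp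
  qed
  then show thesis
    using that B by blast
qed

lemma (in graph) coalition_partition_of_rd_partition:
  assumes n: "card (verts G) \<ge> 2" and \<pi>: "rd_partition G \<pi>"
  shows "\<exists>\<sigma>. coalition_partition G \<sigma> \<and> card \<pi> \<le> card \<sigma>"
proof (cases "\<exists>A\<in>\<pi>. dominating_set G A \<and> \<not> restrained_dominating_set G A")
  case False
  then have dom_iff: "dominating_set G A \<longleftrightarrow> restrained_dominating_set G A" if "A \<in> \<pi>" for A
    using that unfolding restrained_dominating_set_def by blast
  have "coalition G A B" if "A \<in> \<pi>" "B \<in> \<pi>" "rd_coalition G A B" for A B
    using that dom_iff[of A] dom_iff[of B]
    unfolding coalition_def rd_coalition_def restrained_dominating_set_def[of G "A \<union> B"] by simp
  then have "coalition_partition G \<pi>"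
    using \<pi> dom_iff unfolding coalition_partition_def rd_partition_def by (meson DiffD1)
  then show ?thesis
    by blast
next
  case True
  then obtain A where A: "A \<in> \<pi>" "dominating_set G A" "\<not> restrained_dominating_set G A"
    by blast
  obtain B where B: "B \<in> \<pi> - {A}" and star: "\<And>X. X \<in> \<pi> - {B} \<Longrightarrow> rd_coalition G X B"
    using rd_partition_star[OF \<pi> A] by blast
  have part: "partition_on (verts G) \<pi>"
    using \<pi> unfolding rd_partition_def by blast
  show ?thesis
  proof (cases "dominating_set G B")
    case False
    have "dominating_set G (B \<union> X)" if "X \<in> \<pi> - {B}" for X
      using star[OF that]
      unfolding rd_coalition_def restrained_dominating_set_def by (simp add: Un_commute)
    then show ?thesis
      using coalition_partition_of_star[OF part _ False] B by blast
  next
    case True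
    have nrdB: "\<not> restrained_dominating_set G B"
      using star[of A] A B unfolding rd_coalition_def by blast
    obtain v where v: "v \<in> verts G - B" and nb: "\<And>u. u \<in> verts G - B \<Longrightarrow> \<not> v \<rightarrow>\<^bsub>G\<^esub> u"
      using True nrdB unfolding restrained_dominating_set_def by blast
    \<comment> \<open>The union of \<open>X\<close> and \<open>B\<close> is restrained dominating, so \<open>v\<close> cannot lie
      outside it without a neighbour there.\<close>
    have "v \<in> X" if "X \<in> \<pi> - {B}" for X
      using star[OF that] v nb
      unfolding rd_coalition_def restrained_dominating_set_def by blast
    then have "X = A" if "X \<in> \<pi> - {B}" for X
      using partition_on_unique[OF part, of X A v] that A B by blast
    then have "\<pi> = {A, B}"
      using A B by blast
    then have "card \<pi> \<le> 2"
      by (simp add: card_insert_if)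
    then show ?thesis
      using coalition_partition_two_members[OF n] le_trans by blast
  qed
qed

section \<open>Comparison of the two numbers\<close>

lemma (in graph) card_le_coalition_number:
  assumes "coalition_partition G \<sigma>"
  shows "card \<sigma> \<le> coalition_number G"
proof -
  have "card \<pi> \<le> card (Pow (verts G))" if "coalition_partition G \<pi>" for \<pi>
  proof (rule card_mono)
    show "\<pi> \<subseteq> Pow (verts G)"
      using that unfolding coalition_partition_def partition_on_def by blast
  qed simp
  then have "bdd_above {card \<pi> |\<pi>. coalition_partition G \<pi>}"
    by (intro bdd_aboveI[of _ "card (Pow (verts G))"]) blast
  then show ?thesis
    unfolding coalition_number_def using assms by (intro cSup_upper) blast
qed

theorem theorem1:
  fixes G :: "('a, 'b) pre_digraph"
  assumes "graph G"
    and "connected G"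
    and "card (verts G) \<ge> 2"
  shows "rd_coalition_number G \<le> coalition_number G"
proof (cases "{card \<pi> |\<pi>. rd_partition G \<pi>} = {}")
  case True
  show ?thesis
    unfolding rd_coalition_number_def True by simp
next
  case False
  have "card \<pi> \<le> coalition_number G" if "rd_partition G \<pi>" for \<pi>
    using graph.coalition_partition_of_rd_partition[OF assms(1,3) that]
      graph.card_le_coalition_number[OF assms(1)] le_trans by blast
  then show ?thesis
    unfolding rd_coalition_number_def using False by (intro cSup_least) blast+
qed

end
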